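(* Let $\phi$ be a TTL$[X_\theta,Y_\theta]$ formula. For every subformula (occurrence) $\eta$ of $\phi$ one can effectively construct an MITL$[F,P]$ formula $\alpha(\eta)$ such that for every timed word $\rho$ and every $j\in dom(\rho)$: $pos_\rho(\eta)=j$ iff $\rho,j\models\alpha(\eta)$.
   Context: Fix a finite alphabet $\Sigma$. A timed word is $\rho=(\sigma_1,\tau_1)\cdots(\sigma_n,\tau_n)$, $n\ge1$, $\sigma_i\in\Sigma$, $\tau_i\in\mathbb{R}_{\ge0}$, $\tau_1=0$, $\tau_i\le\tau_{i+1}$; $\#\rho=n$, $dom(\rho)=\{1,\dots,n\}$. Freeze variables: a finite set $\mathcal{X}$; valuations $\nu:\mathcal{X}\to\mathbb{R}_{\ge0}$, $\nu_0\equiv0$, $\nu[x\mapsto r]$ the update. Guards $g::=g\wedge g\mid x-T\approx c$ ($\approx\in\{<,\le,>,\ge,=\}$, $c\in\mathbb{Z}$), $\nu,t\models x-T\approx c$ iff $\nu(x)-t\approx c$. A guarded event is $\theta=(a,g)$ with $a\in\Sigma$. TTL$[X_\theta,Y_\theta]$ formulas: $\phi::=\top\mid\theta\mid SP\phi\mid EP\phi\mid X_\theta\phi\mid Y_\theta\phi\mid x.\phi\mid\phi\vee\phi\mid\neg\phi$, with: $\rho,i,\nu\models\theta$ iff $\sigma_i=a$ and $\nu,\tau_i\models g$; $\rho,i,\nu\models SP\phi$ iff $\rho,1,\nu\models\phi$; $\rho,i,\nu\models EP\phi$ iff $\rho,\#\rho,\nu\models\phi$; $\rho,i,\nu\models X_\theta\phi$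 iff there is $j>i$ with $\rho,j,\nu\models\theta$, $\rho,k,\nu\not\models\theta$ for all $i<k<j$, and $\rho,j,\nu\models\phi$; $Y_\theta$ symmetric to the left; $\rho,i,\nu\models x.\phi$ iff $\rho,i,\nu[x\mapsto\tau_i]\models\phi$. Subformulas are nodes of the parse tree of $\phi$; $\eta_{root}=\phi$. For a timed word $\rho$, $pos_\rho(\eta)\in dom(\rho)\cup\{\bot\}$ and (when $pos_\rho(\eta)\ne\bot$) a valuation $val_\rho(\eta)$ are defined top-down: $pos_\rho(\eta_{root})=1$, $val_\rho(\eta_{root})=\nu_0$; if $pos_\rho(\eta)=\bot$ then all children have $pos=\bot$; otherwise let $pos_\rho(\eta)=i$, $val_\rho(\eta)=\nu$: if $\eta=SP\eta_1$ then $pos_\rho(\eta_1)=1$; if $\eta=EP\eta_1$ then $pos_\rho(\eta_1)=\#\rho$; if $\eta=\eta_1\vee\eta_2$ or $\eta=\neg\eta_1$ then the children have position $i$; in these cases the children get valuation $\nu$; if $\eta=x.\eta_1$ then $pos_\rho(\eta_1)=i$, $val_\rho(\eta_1)=\nu[x\mapsto\tau_i]$; if $\eta=X_\theta\eta_1$ then $pos_\rho(\eta_1)$ is the least $j>i$ with $\rho,j,\nu\models\theta$ ($\bot$ if none) and $val_\rho(\eta_1)=\nu$; $Y_\theta\eta_1$ symmetric (greatest $j<i$). MITL$[F,P]$ formulas: $\psi::=a\mid\psi\wedge\psi\mid\neg\psi\mid F_I\psi\mid P_I\psi$ with $I$ a non-singular interval (convex subset of $\mathbb{R}_{\ge0}$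 with non-negative integer or $\infty$ endpoints, not of form $[c,c]$); $\rho,i\models F_I\psi$ iff $\exists j>i$: $\tau_j-\tau_i\in I$, $\rho,j\models\psi$; $\rho,i\models P_I\psi$ iff $\exists j<i$: $\tau_i-\tau_j\in I$, $\rho,j\models\psi$. *)

theory Defs
  imports Complex_Main "HOL-Library.Countable" "HOL-Library.Nat_Bijection"
begin

section \<open>Timed words\<close>

text \<open>Positions of a timed word are numbered from 1.\<close>

type_synonym 'a tword = "('a \<times> real) list"

definition letter_at :: "'a tword \<Rightarrow> nat \<Rightarrow> 'a" where
  "letter_at \<rho> i = fst (\<rho> ! (i - 1))"

definition time_at :: "'a tword \<Rightarrow> nat \<Rightarrow> real" where
  "time_at \<rho> i = snd (\<rho> ! (i - 1))"

definition wdom :: "'a tword \<Rightarrow> nat set" where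
  "wdom \<rho> = {1..length \<rho>}"

definition timed_word :: "'a tword \<Rightarrow> bool" where
  "timed_word \<rho> \<longleftrightarrow>
     length \<rho> \<ge> 1 \<and>
     time_at \<rho> 1 = 0 \<and>
     (\<forall>i\<in>wdom \<rho>. 0 \<le> time_at \<rho> i) \<and>
     (\<forall>i. 1 \<le> i \<and> i < length \<rho> \<longrightarrow> time_at \<rho> i \<le> time_at \<rho> (i + 1))"


section \<open>TTL\<close>

datatype cmp = Lt | Le | Gt | Ge | Eq

text \<open>\<open>Diff x r c\<close> is the constraint \<open>x - T r c\<close>.\<close>

datatype 'x guard = GAnd "'x guard" "'x guard" | Diff 'x cmp int

type_synonym ('a, 'x) event = "'a \<times> 'x guard"

datatype ('a, 'x) ttl =
    Top
  | Ev "('a, 'x) event"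
  | SP "('a, 'x) ttl"
  | EP "('a, 'x) ttl"
  | Nxt "('a, 'x) event" "('a, 'x) ttl"  (* X_theta *)
  | Prv "('a, 'x) event" "('a, 'x) ttl"  (* Y_theta *)
  | Frz 'x "('a, 'x) ttl"
  | Or "('a, 'x) ttl" "('a, 'x) ttl"
  | Neg "('a, 'x) ttl"

text \<open>Every valuation that arises from the zero valuation by freezing time stamps of a timed word
  is non-negative, so real-valued valuations suffice.\<close>

type_synonym 'x valuation = "'x \<Rightarrow> real"

definition zero_val :: "'x valuation" where
  "zero_val = (\<lambda>_. 0)"

primrec cmp_sat :: "cmp \<Rightarrow> real \<Rightarrow> real \<Rightarrow> bool" where
  "cmp_sat Lt a b \<longleftrightarrow> a < b"
| "cmp_sat Le a b \<longleftrightarrow> a \<le> b"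
| "cmp_sat Gt a b \<longleftrightarrow> a > b"
| "cmp_sat Ge a b \<longleftrightarrow> a \<ge> b"
| "cmp_sat Eq a b \<longleftrightarrow> a = b"

primrec guard_sat :: "'x valuation \<Rightarrow> real \<Rightarrow> 'x guard \<Rightarrow> bool" where
  "guard_sat \<nu> t (GAnd g h) \<longleftrightarrow> guard_sat \<nu> t g \<and> guard_sat \<nu> t h"
| "guard_sat \<nu> t (Diff x r c) \<longleftrightarrow> cmp_sat r (\<nu> x - t) (of_int c)"

definition event_sat :: "'a tword \<Rightarrow> nat \<Rightarrow> 'x valuation \<Rightarrow> ('a, 'x) event \<Rightarrow> bool" where
  "event_sat \<rho> i \<nu> \<theta> \<longleftrightarrow>
     letter_at \<rho> i = fst \<theta> \<and> guard_sat \<nu> (time_at \<rho> i) (snd \<theta>)"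

primrec ttl_sat :: "'a tword \<Rightarrow> nat \<Rightarrow> 'x valuation \<Rightarrow> ('a, 'x) ttl \<Rightarrow> bool" where
  "ttl_sat \<rho> i \<nu> Top \<longleftrightarrow> True"
| "ttl_sat \<rho> i \<nu> (Ev \<theta>) \<longleftrightarrow> event_sat \<rho> i \<nu> \<theta>"
| "ttl_sat \<rho> i \<nu> (SP \<phi>) \<longleftrightarrow> ttl_sat \<rho> 1 \<nu> \<phi>"
| "ttl_sat \<rho> i \<nu> (EP \<phi>) \<longleftrightarrow> ttl_sat \<rho> (length \<rho>) \<nu> \<phi>"
| "ttl_sat \<rho> i \<nu> (Nxt \<theta> \<phi>) \<longleftrightarrow>
     (\<exists>j\<in>wdom \<rho>. i < j \<and> event_sat \<rho> j \<nu> \<theta> \<and>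
        (\<forall>k. i < k \<and> k < j \<longrightarrow> \<not> event_sat \<rho> k \<nu> \<theta>) \<and> ttl_sat \<rho> j \<nu> \<phi>)"
| "ttl_sat \<rho> i \<nu> (Prv \<theta> \<phi>) \<longleftrightarrow>
     (\<exists>j\<in>wdom \<rho>. j < i \<and> event_sat \<rho> j \<nu> \<theta> \<and>
        (\<forall>k. j < k \<and> k < i \<longrightarrow> \<not> event_sat \<rho> k \<nu> \<theta>) \<and> ttl_sat \<rho> j \<nu> \<phi>)"
| "ttl_sat \<rho> i \<nu> (Frz x \<phi>) \<longleftrightarrow> ttl_sat \<rho> i (\<nu>(x := time_at \<rho> i)) \<phi>"
| "ttl_sat \<rho> i \<nu> (Or \<phi> \<psi>) \<longleftrightarrow> ttl_sat \<rho> i \<nu> \<phi> \<or> ttl_sat \<rho> i \<nu> \<psi>"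
| "ttl_sat \<rho> i \<nu> (Neg \<phi>) \<longleftrightarrow> \<not> ttl_sat \<rho> i \<nu> \<phi>"


section \<open>Subformula occurrences, their positions and valuations\<close>

text \<open>A node of the parse tree is addressed by the list of child indices (from 0) on the path
  leading to it from the root.\<close>

primrec children :: "('a, 'x) ttl \<Rightarrow> ('a, 'x) ttl list" where
  "children Top = []"
| "children (Ev \<theta>) = []"
| "children (SP \<phi>) = [\<phi>]"
| "children (EP \<phi>) = [\<phi>]"
| "children (Nxt \<theta> \<phi>) = [\<phi>]"
| "children (Prv \<theta> \<phi>) = [\<phi>]"
| "children (Frz x \<phi>) = [\<phi>]"
| "children (Or \<phi> \<psi>) = [\<phi>, \<psi>]"
| "children (Neg \<phi>) = [\<phi>]"

fun is_node :: "('a, 'x) ttl \<Rightarrow> nat list \<Rightarrow> bool" where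
  "is_node \<phi> [] \<longleftrightarrow> True"
| "is_node \<phi> (d # p) \<longleftrightarrow> d < length (children \<phi>) \<and> is_node (children \<phi> ! d) p"

text \<open>\<open>child_state \<rho> \<eta> i \<nu>\<close> is the position and valuation of the children of \<open>\<eta>\<close>, if \<open>\<eta>\<close> itself
  has position \<open>i\<close> and valuation \<open>\<nu>\<close>; it does not depend on the child. \<open>None\<close> is the undefined
  position.\<close>

primrec child_state ::
  "'a tword \<Rightarrow> ('a, 'x) ttl \<Rightarrow> nat \<Rightarrow> 'x valuation \<Rightarrow> (nat \<times> 'x valuation) option" where
  "child_state \<rho> Top i \<nu> = None"
| "child_state \<rho> (Ev \<theta>) i \<nu> = None"
| "child_state \<rho> (SP \<phi>) i \<nu> = Some (1, \<nu>)"
| "child_state \<rho> (EP \<phi>) i \<nu> = Some (length \<rho>, \<nu>)"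
| "child_state \<rho> (Nxt \<theta> \<phi>) i \<nu> =
     (if \<exists>j\<in>wdom \<rho>. i < j \<and> ttl_sat \<rho> j \<nu> (Ev \<theta>)
      then Some (LEAST j. j \<in> wdom \<rho> \<and> i < j \<and> ttl_sat \<rho> j \<nu> (Ev \<theta>), \<nu>) else None)"
| "child_state \<rho> (Prv \<theta> \<phi>) i \<nu> =
     (if \<exists>j\<in>wdom \<rho>. j < i \<and> ttl_sat \<rho> j \<nu> (Ev \<theta>)
      then Some (GREATEST j. j \<in> wdom \<rho> \<and> j < i \<and> ttl_sat \<rho> j \<nu> (Ev \<theta>), \<nu>) else None)"
| "child_state \<rho> (Frz x \<phi>) i \<nu> = Some (i, \<nu>(x := time_at \<rho> i))"
| "child_state \<rho> (Or \<phi> \<psi>) i \<nu> = Some (i, \<nu>)"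
| "child_state \<rho> (Neg \<phi>) i \<nu> = Some (i, \<nu>)"

fun descend :: "'a tword \<Rightarrow> ('a, 'x) ttl \<Rightarrow> (nat \<times> 'x valuation) option \<Rightarrow> nat list
    \<Rightarrow> (nat \<times> 'x valuation) option" where
  "descend \<rho> \<phi> s [] = s"
| "descend \<rho> \<phi> s (d # p) =
     descend \<rho> (children \<phi> ! d)
       (case s of None \<Rightarrow> None | Some (i, \<nu>) \<Rightarrow> child_state \<rho> \<phi> i \<nu>) p"

definition pos :: "'a tword \<Rightarrow> ('a, 'x) ttl \<Rightarrow> nat list \<Rightarrow> nat option" where
  "pos \<rho> \<phi> p = map_option fst (descend \<rho> \<phi> (Some (1, zero_val)) p)"


section \<open>MITL with F and P\<close>

text \<open>An interval is given by its lower and its upper endpoint; \<open>None\<close> is the upper endpoint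
  infinity.\<close>

datatype endpoint = Closed nat | Open nat

datatype ival = Ival endpoint "endpoint option"

primrec above :: "endpoint \<Rightarrow> real \<Rightarrow> bool" where
  "above (Closed c) t \<longleftrightarrow> real c \<le> t"
| "above (Open c) t \<longleftrightarrow> real c < t"

primrec below :: "endpoint \<Rightarrow> real \<Rightarrow> bool" where
  "below (Closed c) t \<longleftrightarrow> t \<le> real c"
| "below (Open c) t \<longleftrightarrow> t < real c"

primrec ival_set :: "ival \<Rightarrow> real set" where
  "ival_set (Ival l u) =
     {t. above l t \<and> (case u of None \<Rightarrow> True | Some b \<Rightarrow> below b t)}"

definition nonsingular :: "ival \<Rightarrow> bool" where
  "nonsingular I \<longleftrightarrow> (\<nexists>c::nat. ival_set I = {real c..real c})"

datatype 'a mitl =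
    Letter 'a
  | Conj "'a mitl" "'a mitl"
  | Not "'a mitl"
  | F ival "'a mitl"
  | P ival "'a mitl"

text \<open>The raw datatype admits arbitrary intervals; the formulas of MITL are those in which all
  intervals are non-singular.\<close>

primrec is_mitl :: "'a mitl \<Rightarrow> bool" where
  "is_mitl (Letter a) \<longleftrightarrow> True"
| "is_mitl (Conj \<psi> \<chi>) \<longleftrightarrow> is_mitl \<psi> \<and> is_mitl \<chi>"
| "is_mitl (Not \<psi>) \<longleftrightarrow> is_mitl \<psi>"
| "is_mitl (F I \<psi>) \<longleftrightarrow> nonsingular I \<and> is_mitl \<psi>"
| "is_mitl (P I \<psi>) \<longleftrightarrow> nonsingular I \<and> is_mitl \<psi>"

primrec mitl_sat :: "'a tword \<Rightarrow> nat \<Rightarrow> 'a mitl \<Rightarrow> bool" where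
  "mitl_sat \<rho> i (Letter a) \<longleftrightarrow> letter_at \<rho> i = a"
| "mitl_sat \<rho> i (Conj \<psi> \<chi>) \<longleftrightarrow> mitl_sat \<rho> i \<psi> \<and> mitl_sat \<rho> i \<chi>"
| "mitl_sat \<rho> i (Not \<psi>) \<longleftrightarrow> \<not> mitl_sat \<rho> i \<psi>"
| "mitl_sat \<rho> i (F I \<psi>) \<longleftrightarrow>
     (\<exists>j\<in>wdom \<rho>. j > i \<and> time_at \<rho> j - time_at \<rho> i \<in> ival_set I \<and> mitl_sat \<rho> j \<psi>)"
| "mitl_sat \<rho> i (P I \<psi>) \<longleftrightarrow>
     (\<exists>j\<in>wdom \<rho>. j < i \<and> time_at \<rho> i - time_at \<rho> j \<in> ival_set I \<and> mitl_sat \<rho> j \<psi>)"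


section \<open>Effectivity\<close>

text \<open>\<open>recfn n f\<close>: restricted to lists of length \<open>n\<close>, \<open>f\<close> is an \<open>n\<close>-ary total recursive function
  (Kleene's characterization, where minimization is applied to regular functions only). The values
  of \<open>f\<close> on lists of other lengths carry no meaning.\<close>

inductive recfn :: "nat \<Rightarrow> (nat list \<Rightarrow> nat) \<Rightarrow> bool" where
  zero: "recfn n (\<lambda>xs. 0)"
| succ: "recfn 1 (\<lambda>xs. Suc (hd xs))"
| proj: "i < n \<Longrightarrow> recfn n (\<lambda>xs. xs ! i)"
| comp: "recfn (length gs) f \<Longrightarrow> \<forall>g\<in>set gs. recfn n g \<Longrightarrow>
    recfn n (\<lambda>xs. f (map (\<lambda>g. g xs) gs))"
| prim_rec: "recfn n f \<Longrightarrow> recfn (n + 2) g \<Longrightarrow>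
    recfn (n + 1) (\<lambda>xs. rec_nat (f (tl xs)) (\<lambda>m r. g (m # r # tl xs)) (hd xs))"
| minim: "recfn (n + 1) f \<Longrightarrow> \<forall>xs. length xs = n \<longrightarrow> (\<exists>y. f (y # xs) = 0) \<Longrightarrow>
    recfn n (\<lambda>xs. LEAST y. f (y # xs) = 0)"

text \<open>Goedel numberings. Letters and freeze variables range over finite types, where
  every numbering, in particular \<open>to_nat\<close>, is as good as any other. On the infinite types \<open>to_nat\<close>
  would be an arbitrary, possibly non-computable injection, so the numberings are explicit there.\<close>

primrec gn_cmp :: "cmp \<Rightarrow> nat" where
  "gn_cmp Lt = 0"
| "gn_cmp Le = 1"
| "gn_cmp Gt = 2"
| "gn_cmp Ge = 3"
| "gn_cmp Eq = 4"

primrec gn_guard :: "'x::finite guard \<Rightarrow> nat" where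
  "gn_guard (GAnd g h) = list_encode [0, gn_guard g, gn_guard h]"
| "gn_guard (Diff x r c) = list_encode [1, to_nat x, gn_cmp r, int_encode c]"

definition gn_event :: "('a::finite, 'x::finite) event \<Rightarrow> nat" where
  "gn_event \<theta> = prod_encode (to_nat (fst \<theta>), gn_guard (snd \<theta>))"

primrec gn_ttl :: "('a::finite, 'x::finite) ttl \<Rightarrow> nat" where
  "gn_ttl Top = list_encode [0]"
| "gn_ttl (Ev \<theta>) = list_encode [1, gn_event \<theta>]"
| "gn_ttl (SP \<phi>) = list_encode [2, gn_ttl \<phi>]"
| "gn_ttl (EP \<phi>) = list_encode [3, gn_ttl \<phi>]"
| "gn_ttl (Nxt \<theta> \<phi>) = list_encode [4, gn_event \<theta>, gn_ttl \<phi>]"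
| "gn_ttl (Prv \<theta> \<phi>) = list_encode [5, gn_event \<theta>, gn_ttl \<phi>]"
| "gn_ttl (Frz x \<phi>) = list_encode [6, to_nat x, gn_ttl \<phi>]"
| "gn_ttl (Or \<phi> \<psi>) = list_encode [7, gn_ttl \<phi>, gn_ttl \<psi>]"
| "gn_ttl (Neg \<phi>) = list_encode [8, gn_ttl \<phi>]"

primrec gn_endpoint :: "endpoint \<Rightarrow> nat" where
  "gn_endpoint (Closed c) = prod_encode (0, c)"
| "gn_endpoint (Open c) = prod_encode (1, c)"

primrec gn_ival :: "ival \<Rightarrow> nat" where
  "gn_ival (Ival l u) =
     prod_encode (gn_endpoint l, case u of None \<Rightarrow> 0 | Some b \<Rightarrow> Suc (gn_endpoint b))"

primrec gn_mitl :: "'a::finite mitl \<Rightarrow> nat" where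
  "gn_mitl (Letter a) = list_encode [0, to_nat a]"
| "gn_mitl (Conj \<psi> \<chi>) = list_encode [1, gn_mitl \<psi>, gn_mitl \<chi>]"
| "gn_mitl (Not \<psi>) = list_encode [2, gn_mitl \<psi>]"
| "gn_mitl (F I \<psi>) = list_encode [3, gn_ival I, gn_mitl \<psi>]"
| "gn_mitl (P I \<psi>) = list_encode [4, gn_ival I, gn_mitl \<psi>]"

lemma gn_cmp_eq: "gn_cmp r = gn_cmp s \<longleftrightarrow> r = s"
  by (cases r; cases s) simp_all

lemma gn_guard_eq: "gn_guard g = gn_guard h \<longleftrightarrow> g = h"
proof (induction g arbitrary: h)
  case (GAnd g1 g2)
  then show ?case by (cases h) simp_all
next
  case (Diff x r c)
  then show ?case by (cases h) (simp_all add: gn_cmp_eq int_encode_eq)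
qed

lemma gn_event_eq: "gn_event \<theta> = gn_event \<theta>' \<longleftrightarrow> \<theta> = \<theta>'"
  by (simp add: gn_event_def gn_guard_eq prod_eq_iff)

lemma gn_ttl_eq: "gn_ttl \<phi> = gn_ttl \<psi> \<longleftrightarrow> \<phi> = \<psi>"
proof (induction \<phi> arbitrary: \<psi>)
  case Top show ?case by (cases \<psi>) simp_all
next
  case (Ev \<theta>) show ?case by (cases \<psi>) (simp_all add: gn_event_eq)
next
  case (SP \<phi>) then show ?case by (cases \<psi>) simp_all
next
  case (EP \<phi>) then show ?case by (cases \<psi>) simp_all
next
  case (Nxt \<theta> \<phi>) then show ?case by (cases \<psi>) (simp_all add: gn_event_eq)
next
  case (Prv \<theta> \<phi>) then show ?case by (cases \<psi>) (simp_all add: gn_event_eq)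
next
  case (Frz x \<phi>) then show ?case by (cases \<psi>) simp_all
next
  case (Or \<phi>1 \<phi>2) then show ?case by (cases \<psi>) simp_all
next
  case (Neg \<phi>) then show ?case by (cases \<psi>) simp_all
qed

lemma gn_endpoint_eq: "gn_endpoint l = gn_endpoint u \<longleftrightarrow> l = u"
  by (cases l; cases u) simp_all

lemma gn_ival_eq: "gn_ival I = gn_ival J \<longleftrightarrow> I = J"
  by (cases I; cases J) (auto simp: gn_endpoint_eq split: option.splits)

lemma gn_mitl_eq: "gn_mitl \<psi> = gn_mitl \<chi> \<longleftrightarrow> \<psi> = \<chi>"
proof (induction \<psi> arbitrary: \<chi>)
  case (Letter a) show ?case by (cases \<chi>) simp_all
next
  case (Conj \<psi>1 \<psi>2) then show ?case by (cases \<chi>) simp_all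
next
  case (Not \<psi>) then show ?case by (cases \<chi>) simp_all
next
  case (F I \<psi>) then show ?case by (cases \<chi>) (simp_all add: gn_ival_eq)
next
  case (P I \<psi>) then show ?case by (cases \<chi>) (simp_all add: gn_ival_eq)
qed

definition effective :: "(('a::finite, 'x::finite) ttl \<Rightarrow> nat list \<Rightarrow> 'a mitl) \<Rightarrow> bool" where
  "effective \<alpha> \<longleftrightarrow>
     (\<exists>f. recfn 2 f \<and>
        (\<forall>\<phi> p. is_node \<phi> p \<longrightarrow> f [gn_ttl \<phi>, list_encode p] = gn_mitl (\<alpha> \<phi> p)))"

end

theory Submission
  imports Defs
begin

text \<open>A node that is reached has exactly one position, and each of its frozen variables holds the time
  stamp of exactly one position. By descending the parse tree one obtains formulas that mark these
  positions. Uniqueness turns a guard at a node into a Boolean combination of statements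
  \<open>F\<^sub>I \<psi>\<close> and \<open>P\<^sub>I \<psi>\<close> with \<open>I\<close> unbounded, and makes the nearest event after the marked position
  definable: it satisfies the event, lies after the mark, and has no such position before it.\<close>

section \<open>The translation\<close>

text \<open>Undefined positions shape the construction. The formula of a node that is never reached
  must be false everywhere, and below such a node the environment may hold formulas that mark
  nothing; every child formula is therefore built so that it can hold only if the parent's formula
  holds somewhere. Truth values of subformulas never enter: a node's position depends only on the
  operators along its path, with their guards and freezes, so a single descent computes the formula.
  For effectivity the obstacle is that Kleene's schemes recurse on one number with fixed parameters,
  whereas the translation changes its arguments as it descends and branches on guards.\<close>

definition marks :: "'a tword \<Rightarrow> 'a mitl \<Rightarrow> nat \<Rightarrow> bool" where
  "marks \<rho> \<psi> k \<longleftrightarrow> k \<in> wdom \<rho> \<and> (\<forall>j\<in>wdom \<rho>. mitl_sat \<rho> j \<psi> \<longleftrightarrow> j = k)"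

lemma time_at_mono:
  assumes "timed_word \<rho>" "i \<in> wdom \<rho>" "j \<in> wdom \<rho>" "i \<le> j"
  shows "time_at \<rho> i \<le> time_at \<rho> j"
proof -
  have "j \<le> length \<rho> \<longrightarrow> time_at \<rho> i \<le> time_at \<rho> j"
    using \<open>i \<le> j\<close>
  proof (induction rule: dec_induct)
    case (step n)
    have "Suc n \<le> length \<rho> \<Longrightarrow> time_at \<rho> n \<le> time_at \<rho> (n + 1)"
      using step assms(1,2) by (auto simp: timed_word_def wdom_def)
    then show ?case using step by auto
  qed simp
  then show ?thesis using assms(3) by (simp add: wdom_def)
qed

section \<open>Comparisons with a frozen time stamp\<close>

abbreviation at_least :: "nat \<Rightarrow> ival" where
  "at_least c \<equiv> Ival (Closed c) None"

abbreviation greater :: "nat \<Rightarrow> ival" where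
  "greater c \<equiv> Ival (Open c) None"

lemma nonsingular_unbounded: "nonsingular (Ival l None)"
proof -
  have "ival_set (Ival l None) \<noteq> {real c..real c}" for c
  proof
    assume *: "ival_set (Ival l None) = {real c..real c}"
    then have "above l (real c)" by auto
    then have "above l (real c + 1)" by (cases l) auto
    then have "real c + 1 \<in> ival_set (Ival l None)" by simp
    then show False unfolding * by simp
  qed
  then show ?thesis by (simp add: nonsingular_def)
qed

text \<open>If \<open>\<psi>\<close> marks the position where \<open>x\<close> was frozen, these express \<open>x - T < c\<close> and
  \<open>x - T \<le> c\<close>. Case distinction on the sign of \<open>c\<close> makes unbounded intervals sufficient, so that
  equality constraints do not lead to singular intervals.\<close>

definition lt_form :: "'a mitl \<Rightarrow> int \<Rightarrow> 'a mitl" where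
  "lt_form \<psi> c = (if c > 0 then Not (F (at_least (nat \<bar>c\<bar>)) \<psi>) else P (greater (nat \<bar>c\<bar>)) \<psi>)"

definition le_form :: "'a mitl \<Rightarrow> int \<Rightarrow> 'a mitl" where
  "le_form \<psi> c = (if c \<ge> 0 then Not (F (greater (nat \<bar>c\<bar>)) \<psi>) else P (at_least (nat \<bar>c\<bar>)) \<psi>)"

primrec cmp_form :: "'a mitl \<Rightarrow> int \<Rightarrow> cmp \<Rightarrow> 'a mitl" where
  "cmp_form \<psi> c Lt = lt_form \<psi> c"
| "cmp_form \<psi> c Le = le_form \<psi> c"
| "cmp_form \<psi> c Gt = Not (le_form \<psi> c)"
| "cmp_form \<psi> c Ge = Not (lt_form \<psi> c)"
| "cmp_form \<psi> c Eq = Conj (le_form \<psi> c) (Not (lt_form \<psi> c))"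

lemma is_mitl_cmp_form: "is_mitl \<psi> \<Longrightarrow> is_mitl (cmp_form \<psi> c r)"
  by (cases r) (simp_all add: lt_form_def le_form_def nonsingular_unbounded)

text \<open>In every branch of \<open>lt_form\<close> and \<open>le_form\<close> the interval
  excludes 0. The operators \<open>F\<close> and \<open>P\<close> cannot see the current position,
  but \<open>k = j\<close> means distance 0, so such a witness is never called for. This is why
  \<open>c = 0\<close> falls into the \<open>P\<close> branch for the strict and into the
  \<open>F\<close> branch for the non-strict comparison.\<close>

lemma mitl_sat_lt_form:
  assumes "timed_word \<rho>" "marks \<rho> \<psi> k" "j \<in> wdom \<rho>"
  shows "mitl_sat \<rho> j (lt_form \<psi> c) \<longleftrightarrow> time_at \<rho> k - time_at \<rho> j < of_int c"
proof -
  have k: "k \<in> wdom \<rho>" and s: "\<And>i. i \<in> wdom \<rho> \<Longrightarrow> mitl_sat \<rho> i \<psi> \<longleftrightarrow> i = k"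
    using assms(2) by (auto simp: marks_def)
  show ?thesis
    using time_at_mono[OF assms(1) k assms(3)] time_at_mono[OF assms(1) assms(3) k] k
    by (cases "k < j"; cases "j < k") (auto simp: lt_form_def s)
qed

lemma mitl_sat_le_form:
  assumes "timed_word \<rho>" "marks \<rho> \<psi> k" "j \<in> wdom \<rho>"
  shows "mitl_sat \<rho> j (le_form \<psi> c) \<longleftrightarrow> time_at \<rho> k - time_at \<rho> j \<le> of_int c"
proof -
  have k: "k \<in> wdom \<rho>" and s: "\<And>i. i \<in> wdom \<rho> \<Longrightarrow> mitl_sat \<rho> i \<psi> \<longleftrightarrow> i = k"
    using assms(2) by (auto simp: marks_def)
  show ?thesis
    using time_at_mono[OF assms(1) k assms(3)] time_at_mono[OF assms(1) assms(3) k] k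
    by (cases "k < j"; cases "j < k") (auto simp: le_form_def s)
qed

lemma mitl_sat_cmp_form:
  assumes "timed_word \<rho>" "marks \<rho> \<psi> k" "j \<in> wdom \<rho>"
  shows "mitl_sat \<rho> j (cmp_form \<psi> c r) \<longleftrightarrow> cmp_sat r (time_at \<rho> k - time_at \<rho> j) (of_int c)"
  by (cases r) (auto simp: mitl_sat_lt_form[OF assms] mitl_sat_le_form[OF assms])

section \<open>Ends of the word and existence of a position\<close>

definition true_form :: "'a mitl" where
  "true_form = Not (Conj (Letter undefined) (Not (Letter undefined)))"

definition first_form :: "'a mitl" where
  "first_form = Not (P (at_least 0) true_form)"

definition last_form :: "'a mitl" where
  "last_form = Not (F (at_least 0) true_form)"

text \<open>A disjunction of here, later and earlier. It serves \<open>SP\<close> and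
  \<open>EP\<close>: where their child sits does not depend on the node's position, but whether the
  child is reached does.\<close>

definition somewhere :: "'a mitl \<Rightarrow> 'a mitl" where
  "somewhere \<psi> = Not (Conj (Not \<psi>) (Conj (Not (F (at_least 0) \<psi>)) (Not (P (at_least 0) \<psi>))))"

lemma mitl_sat_F_unrestricted:
  assumes "timed_word \<rho>" "j \<in> wdom \<rho>"
  shows "mitl_sat \<rho> j (F (at_least 0) \<psi>) \<longleftrightarrow> (\<exists>i\<in>wdom \<rho>. j < i \<and> mitl_sat \<rho> i \<psi>)"
  using time_at_mono[OF assms] by (auto intro: less_imp_le)

lemma mitl_sat_P_unrestricted:
  assumes "timed_word \<rho>" "j \<in> wdom \<rho>"
  shows "mitl_sat \<rho> j (P (at_least 0) \<psi>) \<longleftrightarrow> (\<exists>i\<in>wdom \<rho>. i < j \<and> mitl_sat \<rho> i \<psi>)"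
  using time_at_mono[OF assms(1) _ assms(2)] by (auto intro: less_imp_le)

lemma mitl_sat_true_form: "mitl_sat \<rho> j true_form"
  by (simp add: true_form_def)

lemma marks_first_form:
  assumes "timed_word \<rho>"
  shows "marks \<rho> first_form 1"
proof -
  have 1: "1 \<in> wdom \<rho>" using assms by (simp add: timed_word_def wdom_def)
  have "mitl_sat \<rho> j first_form \<longleftrightarrow> j = 1" if j: "j \<in> wdom \<rho>" for j
  proof -
    have "mitl_sat \<rho> j first_form \<longleftrightarrow> (\<forall>i\<in>wdom \<rho>. \<not> i < j)"
      by (auto simp: first_form_def mitl_sat_P_unrestricted[OF assms j] mitl_sat_true_form
          simp del: mitl_sat.simps(5))
    also have "\<dots> \<longleftrightarrow> j = 1"
      using 1 j by (metis atLeastAtMost_iff le_neq_implies_less not_less wdom_def)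
    finally show ?thesis .
  qed
  then show ?thesis using 1 by (simp add: marks_def)
qed

lemma marks_last_form:
  assumes "timed_word \<rho>"
  shows "marks \<rho> last_form (length \<rho>)"
proof -
  have 1: "length \<rho> \<in> wdom \<rho>" using assms by (simp add: timed_word_def wdom_def)
  have "mitl_sat \<rho> j last_form \<longleftrightarrow> j = length \<rho>" if j: "j \<in> wdom \<rho>" for j
    using mitl_sat_F_unrestricted[OF assms j, of true_form] 1 j
    by (fastforce simp: last_form_def mitl_sat_true_form wdom_def simp del: mitl_sat.simps(4))
  then show ?thesis using 1 by (simp add: marks_def)
qed

lemma mitl_sat_somewhere:
  assumes "timed_word \<rho>" "j \<in> wdom \<rho>"
  shows "mitl_sat \<rho> j (somewhere \<psi>) \<longleftrightarrow> (\<exists>i\<in>wdom \<rho>. mitl_sat \<rho> i \<psi>)"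
  using assms(2) unfolding somewhere_def mitl_sat.simps(2,3)
    mitl_sat_F_unrestricted[OF assms] mitl_sat_P_unrestricted[OF assms]
  by (metis linorder_neqE_nat)

text \<open>The valuation of a node is represented by an association list that maps each frozen variable to
  a formula marking the position at which it was frozen. A variable not in the list has value 0,
  which is the time stamp of the first position.\<close>

type_synonym ('a, 'x) env = "('x \<times> 'a mitl) list"

fun lookup :: "('a, 'x) env \<Rightarrow> 'x \<Rightarrow> 'a mitl" where
  "lookup [] x = first_form"
| "lookup ((y, \<psi>) # e) x = (if y = x then \<psi> else lookup e x)"

text \<open>Constraints are conjoined to an accumulated formula instead of combining two recursive
  results. A loop with a stack of guards and one partial result can then simulate the recursion on
  codes.\<close>

primrec guard_form :: "('a, 'x) env \<Rightarrow> 'x guard \<Rightarrow> 'a mitl \<Rightarrow> 'a mitl" where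
  "guard_form e (GAnd g h) \<psi> = guard_form e h (guard_form e g \<psi>)"
| "guard_form e (Diff x r c) \<psi> = Conj \<psi> (cmp_form (lookup e x) c r)"

definition event_form :: "('a, 'x) env \<Rightarrow> ('a, 'x) event \<Rightarrow> 'a mitl" where
  "event_form e \<theta> = guard_form e (snd \<theta>) (Letter (fst \<theta>))"

definition next_form :: "'a mitl \<Rightarrow> 'a mitl \<Rightarrow> 'a mitl" where
  "next_form \<psi> \<epsilon> =
    Conj (Conj \<epsilon> (P (at_least 0) \<psi>)) (Not (P (at_least 0) (Conj \<epsilon> (P (at_least 0) \<psi>))))"

definition prev_form :: "'a mitl \<Rightarrow> 'a mitl \<Rightarrow> 'a mitl" where
  "prev_form \<psi> \<epsilon> =
    Conj (Conj \<epsilon> (F (at_least 0) \<psi>)) (Not (F (at_least 0) (Conj \<epsilon> (F (at_least 0) \<psi>))))"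

text \<open>Leaves have no children, so the values at \<open>Top\<close> and \<open>Ev\<close> are
  mere defaults.\<close>

primrec child_form :: "('a, 'x) env \<Rightarrow> 'a mitl \<Rightarrow> ('a, 'x) ttl \<Rightarrow> 'a mitl" where
  "child_form e \<psi> Top = \<psi>"
| "child_form e \<psi> (Ev \<theta>) = \<psi>"
| "child_form e \<psi> (SP \<phi>) = Conj first_form (somewhere \<psi>)"
| "child_form e \<psi> (EP \<phi>) = Conj last_form (somewhere \<psi>)"
| "child_form e \<psi> (Nxt \<theta> \<phi>) = next_form \<psi> (event_form e \<theta>)"
| "child_form e \<psi> (Prv \<theta> \<phi>) = prev_form \<psi> (event_form e \<theta>)"
| "child_form e \<psi> (Frz x \<phi>) = \<psi>"
| "child_form e \<psi> (Or \<phi> \<chi>) = \<psi>"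
| "child_form e \<psi> (Neg \<phi>) = \<psi>"

fun child_env :: "('a, 'x) env \<Rightarrow> 'a mitl \<Rightarrow> ('a, 'x) ttl \<Rightarrow> ('a, 'x) env" where
  "child_env e \<psi> (Frz x \<phi>) = (x, \<psi>) # e"
| "child_env e \<psi> \<phi> = e"

fun node_form :: "('a, 'x) env \<Rightarrow> 'a mitl \<Rightarrow> ('a, 'x) ttl \<Rightarrow> nat list \<Rightarrow> 'a mitl" where
  "node_form e \<psi> \<phi> [] = \<psi>"
| "node_form e \<psi> \<phi> (d # p) =
     node_form (child_env e \<psi> \<phi>) (child_form e \<psi> \<phi>) (children \<phi> ! d) p"

lemma is_mitl_first_form: "is_mitl first_form"
  by (simp add: first_form_def true_form_def nonsingular_unbounded)

lemma is_mitl_lookup: "\<forall>(x, \<psi>)\<in>set e. is_mitl \<psi> \<Longrightarrow> is_mitl (lookup e x)"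
  by (induction e x rule: lookup.induct) (auto simp: is_mitl_first_form)

lemma is_mitl_guard_form:
  "\<forall>(x, \<psi>)\<in>set e. is_mitl \<psi> \<Longrightarrow> is_mitl \<psi> \<Longrightarrow> is_mitl (guard_form e g \<psi>)"
  by (induction g arbitrary: \<psi>) (simp_all add: is_mitl_cmp_form is_mitl_lookup)

lemma is_mitl_child_form:
  "\<forall>(x, \<psi>)\<in>set e. is_mitl \<psi> \<Longrightarrow> is_mitl \<psi> \<Longrightarrow> is_mitl (child_form e \<psi> \<phi>)"
  by (cases \<phi>)
    (simp_all add: is_mitl_first_form last_form_def true_form_def somewhere_def next_form_def
      prev_form_def event_form_def is_mitl_guard_form nonsingular_unbounded)

lemma is_mitl_node_form:
  "\<forall>(x, \<psi>)\<in>set e. is_mitl \<psi> \<Longrightarrow> is_mitl \<psi> \<Longrightarrow> is_mitl (node_form e \<psi> \<phi> p)"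
proof (induction e \<psi> \<phi> p rule: node_form.induct)
  case (2 e \<psi> \<phi> d p)
  have "\<forall>(x, \<chi>)\<in>set (child_env e \<psi> \<phi>). is_mitl \<chi>"
    using "2.prems" by (cases \<phi>) auto
  then show ?case
    using 2 by (simp add: is_mitl_child_form)
qed simp

section \<open>Invariant of the descent\<close>

definition env_marks :: "'a tword \<Rightarrow> ('a, 'x) env \<Rightarrow> 'x valuation \<Rightarrow> bool" where
  "env_marks \<rho> e \<nu> \<longleftrightarrow> (\<forall>x. \<exists>k. marks \<rho> (lookup e x) k \<and> \<nu> x = time_at \<rho> k)"

lemma mitl_sat_guard_form:
  assumes "timed_word \<rho>" "env_marks \<rho> e \<nu>" "j \<in> wdom \<rho>"
  shows "mitl_sat \<rho> j (guard_form e g \<psi>) \<longleftrightarrow>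
    mitl_sat \<rho> j \<psi> \<and> guard_sat \<nu> (time_at \<rho> j) g"
proof (induction g arbitrary: \<psi>)
  case (Diff x r c)
  obtain k where "marks \<rho> (lookup e x) k" "\<nu> x = time_at \<rho> k"
    using assms(2) by (auto simp: env_marks_def)
  then show ?case
    using mitl_sat_cmp_form[OF assms(1) _ assms(3)] by simp
qed auto

lemma mitl_sat_event_form:
  assumes "timed_word \<rho>" "env_marks \<rho> e \<nu>" "j \<in> wdom \<rho>"
  shows "mitl_sat \<rho> j (event_form e \<theta>) \<longleftrightarrow> event_sat \<rho> j \<nu> \<theta>"
  by (simp add: event_form_def mitl_sat_guard_form[OF assms] event_sat_def)

text \<open>At an unreached node nothing is asked of the environment: a freeze there records a
  formula that holds nowhere, and guards read from it are meaningless. The invariant survives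
  because each child formula is \<psi> itself or has a conjunct that needs \<psi> at some
  position.\<close>

fun represents :: "'a tword \<Rightarrow> ('a, 'x) env \<Rightarrow> 'a mitl \<Rightarrow> (nat \<times> 'x valuation) option \<Rightarrow> bool" where
  "represents \<rho> e \<psi> None \<longleftrightarrow> (\<forall>j\<in>wdom \<rho>. \<not> mitl_sat \<rho> j \<psi>)"
| "represents \<rho> e \<psi> (Some (i, \<nu>)) \<longleftrightarrow> marks \<rho> \<psi> i \<and> env_marks \<rho> e \<nu>"

lemma mitl_sat_next_form:
  assumes "timed_word \<rho>" "j \<in> wdom \<rho>"
  shows "mitl_sat \<rho> j (next_form \<psi> \<epsilon>) \<longleftrightarrow>
    mitl_sat \<rho> j \<epsilon> \<and> (\<exists>i\<in>wdom \<rho>. i < j \<and> mitl_sat \<rho> i \<psi>) \<and>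
    (\<forall>k\<in>wdom \<rho>. k < j \<longrightarrow> mitl_sat \<rho> k \<epsilon> \<longrightarrow> (\<forall>i\<in>wdom \<rho>. i < k \<longrightarrow> \<not> mitl_sat \<rho> i \<psi>))"
  using assms(2)
  by (auto simp: next_form_def mitl_sat_P_unrestricted[OF assms(1)] simp del: mitl_sat.simps(4,5))

lemma mitl_sat_prev_form:
  assumes "timed_word \<rho>" "j \<in> wdom \<rho>"
  shows "mitl_sat \<rho> j (prev_form \<psi> \<epsilon>) \<longleftrightarrow>
    mitl_sat \<rho> j \<epsilon> \<and> (\<exists>i\<in>wdom \<rho>. j < i \<and> mitl_sat \<rho> i \<psi>) \<and>
    (\<forall>k\<in>wdom \<rho>. j < k \<longrightarrow> mitl_sat \<rho> k \<epsilon> \<longrightarrow> (\<forall>i\<in>wdom \<rho>. k < i \<longrightarrow> \<not> mitl_sat \<rho> i \<psi>))"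
  using assms(2)
  by (auto simp: prev_form_def mitl_sat_F_unrestricted[OF assms(1)] simp del: mitl_sat.simps(4,5))

lemma represents_child_Nxt:
  assumes "timed_word \<rho>" "marks \<rho> \<psi> i" "env_marks \<rho> e \<nu>"
  shows "represents \<rho> e (next_form \<psi> (event_form e \<theta>)) (child_state \<rho> (Nxt \<theta> \<phi>) i \<nu>)"
proof -
  let ?Q = "\<lambda>j. j \<in> wdom \<rho> \<and> i < j \<and> event_sat \<rho> j \<nu> \<theta>"
  have i: "i \<in> wdom \<rho>" "\<And>j. j \<in> wdom \<rho> \<Longrightarrow> mitl_sat \<rho> j \<psi> \<longleftrightarrow> j = i"
    using assms(2) by (auto simp: marks_def)
  \<comment> \<open>Since \<psi> holds at \<open>i\<close> alone, "some earlier position satisfies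
    \<psi>" becomes \<open>i < j\<close>, and the formula describes the least element of
    \<open>?Q\<close>.\<close>
  have sat: "mitl_sat \<rho> j (next_form \<psi> (event_form e \<theta>)) \<longleftrightarrow> ?Q j \<and> (\<forall>k<j. \<not> ?Q k)"
    if "j \<in> wdom \<rho>" for j
    using that i by (auto simp: mitl_sat_next_form[OF assms(1)] mitl_sat_event_form[OF assms(1,3)])
  show ?thesis
  proof (cases "\<exists>j. ?Q j")
    case True
    then have L: "?Q (Least ?Q)" by (rule LeastI_ex)
    have "marks \<rho> (next_form \<psi> (event_form e \<theta>)) (Least ?Q)"
      unfolding marks_def
    proof (intro conjI ballI)
      fix j assume j: "j \<in> wdom \<rho>"
      show "mitl_sat \<rho> j (next_form \<psi> (event_form e \<theta>)) \<longleftrightarrow> j = Least ?Q"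
        unfolding sat[OF j] using L not_less_Least[of _ ?Q] Least_le[of ?Q]
        by (metis (no_types, lifting) le_neq_implies_less)
    qed (use L in blast)
    moreover have "\<exists>j\<in>wdom \<rho>. i < j \<and> event_sat \<rho> j \<nu> \<theta>" using True by blast
    ultimately show ?thesis using assms(3) by simp
  next
    case False
    then have "\<not> (\<exists>j\<in>wdom \<rho>. i < j \<and> event_sat \<rho> j \<nu> \<theta>)" by blast
    then show ?thesis using sat by auto
  qed
qed

lemma represents_child_Prv:
  assumes "timed_word \<rho>" "marks \<rho> \<psi> i" "env_marks \<rho> e \<nu>"
  shows "represents \<rho> e (prev_form \<psi> (event_form e \<theta>)) (child_state \<rho> (Prv \<theta> \<phi>) i \<nu>)"
proof -
  let ?Q = "\<lambda>j. j \<in> wdom \<rho> \<and> j < i \<and> event_sat \<rho> j \<nu> \<theta>"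
  have i: "i \<in> wdom \<rho>" "\<And>j. j \<in> wdom \<rho> \<Longrightarrow> mitl_sat \<rho> j \<psi> \<longleftrightarrow> j = i"
    using assms(2) by (auto simp: marks_def)
  have sat: "mitl_sat \<rho> j (prev_form \<psi> (event_form e \<theta>)) \<longleftrightarrow> ?Q j \<and> (\<forall>k>j. \<not> ?Q k)"
    if "j \<in> wdom \<rho>" for j
    using that i by (auto simp: mitl_sat_prev_form[OF assms(1)] mitl_sat_event_form[OF assms(1,3)])
  \<comment> \<open>A greatest natural number with a property exists only under a bound; the node's
    own position provides it.\<close>
  have bound: "\<And>j. ?Q j \<Longrightarrow> j \<le> i" by simp
  show ?thesis
  proof (cases "\<exists>j. ?Q j")
    case True
    then have G: "?Q (Greatest ?Q)" using bound by (rule GreatestI_ex_nat[of ?Q i])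
    have ge: "?Q j \<Longrightarrow> j \<le> Greatest ?Q" for j
      using bound by (intro Greatest_le_nat[of ?Q j i]) auto
    have "marks \<rho> (prev_form \<psi> (event_form e \<theta>)) (Greatest ?Q)"
      unfolding marks_def
    proof (intro conjI ballI)
      fix j assume j: "j \<in> wdom \<rho>"
      show "mitl_sat \<rho> j (prev_form \<psi> (event_form e \<theta>)) \<longleftrightarrow> j = Greatest ?Q"
        unfolding sat[OF j] using G ge
        by (metis (no_types, lifting) le_neq_implies_less not_less)
    qed (use G in blast)
    moreover have "\<exists>j\<in>wdom \<rho>. j < i \<and> event_sat \<rho> j \<nu> \<theta>" using True by blast
    ultimately show ?thesis using assms(3) by simp
  next
    case False
    then have "\<not> (\<exists>j\<in>wdom \<rho>. j < i \<and> event_sat \<rho> j \<nu> \<theta>)" by blast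
    then show ?thesis using sat by auto
  qed
qed

lemma marks_Conj_somewhere:
  assumes "timed_word \<rho>" "marks \<rho> \<chi> k" "marks \<rho> \<psi> i"
  shows "marks \<rho> (Conj \<chi> (somewhere \<psi>)) k"
  using assms mitl_sat_somewhere[OF assms(1)] by (auto simp: marks_def)

text \<open>Leaves have to be excluded: there \<open>child_state\<close> is \<open>None\<close>,
  whereas \<open>child_form\<close> keeps a formula that may hold.\<close>

lemma represents_child:
  assumes "timed_word \<rho>" "represents \<rho> e \<psi> s" "children \<phi> \<noteq> []"
  shows "represents \<rho> (child_env e \<psi> \<phi>) (child_form e \<psi> \<phi>)
    (case s of None \<Rightarrow> None | Some (i, \<nu>) \<Rightarrow> child_state \<rho> \<phi> i \<nu>)"
proof (cases s)
  case None
  then show ?thesis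
    using assms mitl_sat_somewhere[OF assms(1), of _ \<psi>] mitl_sat_next_form[OF assms(1)]
      mitl_sat_prev_form[OF assms(1)]
    by (cases \<phi>) auto
next
  case (Some s')
  then obtain i \<nu> where s: "s = Some (i, \<nu>)" by (cases s') auto
  with assms have m: "marks \<rho> \<psi> i" and e: "env_marks \<rho> e \<nu>" by auto
  show ?thesis
  proof (cases \<phi>)
    case (SP \<chi>)
    then show ?thesis
      using s e marks_Conj_somewhere[OF assms(1) marks_first_form[OF assms(1)] m] by simp
  next
    case (EP \<chi>)
    then show ?thesis
      using s e marks_Conj_somewhere[OF assms(1) marks_last_form[OF assms(1)] m] by simp
  next
    case (Nxt \<theta> \<chi>)
    then show ?thesis
      using s represents_child_Nxt[OF assms(1) m e] by simp
  next
    case (Prv \<theta> \<chi>)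
    then show ?thesis
      using s represents_child_Prv[OF assms(1) m e] by simp
  next
    case (Frz x \<chi>)
    then show ?thesis
      using s m e by (auto simp: env_marks_def)
  qed (use s m e assms(3) in auto)
qed

lemma represents_node:
  "timed_word \<rho> \<Longrightarrow> represents \<rho> e \<psi> s \<Longrightarrow> is_node \<phi> p \<Longrightarrow>
    \<exists>e'. represents \<rho> e' (node_form e \<psi> \<phi> p) (descend \<rho> \<phi> s p)"
proof (induction p arbitrary: e \<psi> \<phi> s)
  case (Cons d p)
  then have "children \<phi> \<noteq> []" by auto
  from represents_child[OF Cons.prems(1,2) this] show ?case
    using Cons.IH[OF Cons.prems(1)] Cons.prems(3) by simp
qed auto

definition pos_form :: "('a, 'x) ttl \<Rightarrow> nat list \<Rightarrow> 'a mitl" where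
  "pos_form \<phi> p = node_form [] first_form \<phi> p"

lemma is_mitl_pos_form: "is_mitl (pos_form \<phi> p)"
  by (simp add: pos_form_def is_mitl_node_form is_mitl_first_form)

lemma pos_eq_iff_pos_form:
  assumes "timed_word \<rho>" "is_node \<phi> p" "j \<in> wdom \<rho>"
  shows "pos \<rho> \<phi> p = Some j \<longleftrightarrow> mitl_sat \<rho> j (pos_form \<phi> p)"
proof -
  have "env_marks \<rho> [] zero_val"
    using assms(1) marks_first_form[OF assms(1)]
    by (auto simp: env_marks_def zero_val_def timed_word_def)
  then have "represents \<rho> [] first_form (Some (1, zero_val))"
    using marks_first_form[OF assms(1)] by simp
  from represents_node[OF assms(1) this assms(2)] obtain e' where
    "represents \<rho> e' (pos_form \<phi> p) (descend \<rho> \<phi> (Some (1, zero_val)) p)"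
    by (auto simp: pos_form_def)
  then show ?thesis
    using assms(3) unfolding pos_def
    by (cases "descend \<rho> \<phi> (Some (1, zero_val)) p") (auto simp: marks_def)
qed

section \<open>Recursive functions\<close>

text \<open>\<open>recfn\<close> fixes a function also on lists of other lengths, in the syntactic
  shape of the schemes. Closing it under agreement on lists of length \<open>n\<close> gives a
  notion that can be rewritten freely.\<close>

definition computable :: "nat \<Rightarrow> (nat list \<Rightarrow> nat) \<Rightarrow> bool" where
  "computable n f \<longleftrightarrow> (\<exists>g. recfn n g \<and> (\<forall>xs. length xs = n \<longrightarrow> g xs = f xs))"

named_theorems computable_intros

lemma computable_cong:
  "computable n f \<Longrightarrow> (\<And>xs. length xs = n \<Longrightarrow> f xs = g xs) \<Longrightarrow> computable n g"
  by (auto simp: computable_def)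

lemma computable_nth [computable_intros]: "i < n \<Longrightarrow> computable n (\<lambda>xs. xs ! i)"
  unfolding computable_def using recfn.proj by blast

lemma computable_comp:
  assumes "computable (length gs) f" "\<forall>g\<in>set gs. computable n g"
  shows "computable n (\<lambda>xs. f (map (\<lambda>g. g xs) gs))"
proof -
  obtain f' where f': "recfn (length gs) f'" "\<And>xs. length xs = length gs \<Longrightarrow> f' xs = f xs"
    using assms(1) by (auto simp: computable_def)
  \<comment> \<open>\<open>c\<close> picks for each inner function a recursive one that agrees with
    it on lists of length \<open>n\<close>.\<close>
  from assms(2) obtain c where
    c: "\<And>g. g \<in> set gs \<Longrightarrow> recfn n (c g)"
       "\<And>g xs. g \<in> set gs \<Longrightarrow> length xs = n \<Longrightarrow> c g xs = g xs"
    unfolding computable_def by metis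
  have "recfn n (\<lambda>xs. f' (map (\<lambda>g. g xs) (map c gs)))"
    using f'(1) c(1) by (intro recfn.comp) auto
  moreover have "f' (map (\<lambda>g. g xs) (map c gs)) = f (map (\<lambda>g. g xs) gs)" if "length xs = n" for xs
  proof -
    have "map (\<lambda>g. g xs) (map c gs) = map (\<lambda>g. g xs) gs"
      using c(2) that by simp
    then show ?thesis by (simp only: f'(2) length_map)
  qed
  ultimately show ?thesis unfolding computable_def by blast
qed

lemma computable_comp1:
  assumes "computable 1 (\<lambda>xs. f (xs ! 0))" "computable n g"
  shows "computable n (\<lambda>xs. f (g xs))"
  using computable_comp[of "[g]" "\<lambda>xs. f (xs ! 0)" n] assms by simp

lemma computable_comp2:
  assumes "computable 2 (\<lambda>xs. f (xs ! 0) (xs ! 1))" "computable n g" "computable n h"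
  shows "computable n (\<lambda>xs. f (g xs) (h xs))"
  using computable_comp[of "[g, h]" "\<lambda>xs. f (xs ! 0) (xs ! 1)" n] assms
  by (simp add: numeral_2_eq_2)

lemma computable_comp3:
  assumes "computable 3 (\<lambda>xs. f (xs ! 0) (xs ! 1) (xs ! 2))"
    "computable n g" "computable n h" "computable n k"
  shows "computable n (\<lambda>xs. f (g xs) (h xs) (k xs))"
  using computable_comp[of "[g, h, k]" "\<lambda>xs. f (xs ! 0) (xs ! 1) (xs ! 2)" n] assms
  by (simp add: numeral_3_eq_3 numeral_2_eq_2)

section \<open>Arithmetic, iteration and case distinction\<close>

lemma computable_Suc [computable_intros]:
  assumes "computable n f"
  shows "computable n (\<lambda>xs. Suc (f xs))"
proof (rule computable_comp1[OF _ assms])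
  have "Suc (hd xs) = Suc (xs ! 0)" if "length xs = 1" for xs :: "nat list"
    using that by (cases xs) auto
  then show "computable 1 (\<lambda>xs. Suc (xs ! 0))"
    unfolding computable_def using recfn.succ by blast
qed

lemma computable_const [computable_intros]: "computable n (\<lambda>xs. c)"
proof (induction c)
  case 0
  show ?case unfolding computable_def using recfn.zero by blast
qed (rule computable_Suc)

lemma computable_prim_rec:
  assumes "computable n f" "computable (n + 2) g"
  shows "computable (n + 1) (\<lambda>xs. rec_nat (f (tl xs)) (\<lambda>m r. g (m # r # tl xs)) (xs ! 0))"
proof -
  obtain f' g' where f': "recfn n f'" "\<And>xs. length xs = n \<Longrightarrow> f' xs = f xs"
    and g': "recfn (n + 2) g'" "\<And>xs. length xs = n + 2 \<Longrightarrow> g' xs = g xs"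
    using assms unfolding computable_def by metis
  have "rec_nat (f' (tl xs)) (\<lambda>m r. g' (m # r # tl xs)) (hd xs) =
      rec_nat (f (tl xs)) (\<lambda>m r. g (m # r # tl xs)) (xs ! 0)"
    if "length xs = n + 1" for xs
  proof -
    from that obtain x ys where xs: "xs = x # ys" "length ys = n" by (cases xs) auto
    have "rec_nat (f' ys) (\<lambda>m r. g' (m # r # ys)) x = rec_nat (f ys) (\<lambda>m r. g (m # r # ys)) x"
      using xs(2) by (induction x) (simp_all add: f'(2) g'(2))
    then show ?thesis by (simp add: xs(1))
  qed
  then show ?thesis
    unfolding computable_def using recfn.prim_rec[OF f'(1) g'(1)] by blast
qed

lemma computable_minim:
  assumes "computable (n + 1) f" "\<And>xs. length xs = n \<Longrightarrow> \<exists>y. f (y # xs) = 0"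
  shows "computable n (\<lambda>xs. LEAST y. f (y # xs) = 0)"
proof -
  obtain f' where f': "recfn (n + 1) f'" "\<And>xs. length xs = n + 1 \<Longrightarrow> f' xs = f xs"
    using assms(1) unfolding computable_def by metis
  then have "recfn n (\<lambda>xs. LEAST y. f' (y # xs) = 0)"
    using assms(2) by (intro recfn.minim) auto
  then show ?thesis
    unfolding computable_def using f'(2) by (intro exI conjI) auto
qed

lemma computable_rec_nat0:
  assumes "computable 2 (\<lambda>xs. g (xs ! 0) (xs ! 1))" "computable n h"
  shows "computable n (\<lambda>xs. rec_nat c g (h xs))"
proof (rule computable_comp1[OF _ assms(2)])
  show "computable 1 (\<lambda>xs. rec_nat c g (xs ! 0))"
    using computable_prim_rec[OF computable_const[of 0 c], of "\<lambda>xs. g (xs ! 0) (xs ! 1)"] assms(1)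
    by (simp add: numeral_2_eq_2)
qed

lemma computable_rec_nat1:
  assumes "computable 2 (\<lambda>xs. g (xs ! 0) (xs ! 1))" "computable n h" "computable n k"
  shows "computable n (\<lambda>xs. rec_nat (k xs) g (h xs))"
proof (rule computable_comp2[OF _ assms(2,3)])
  have "computable 3 (\<lambda>xs. g (xs ! 0) (xs ! 1))"
    by (rule computable_comp2[OF assms(1)]) (simp_all add: computable_nth)
  then have "computable (1 + 2) (\<lambda>xs. g (xs ! 0) (xs ! 1))" by (simp add: numeral_3_eq_3)
  from computable_prim_rec[OF computable_nth[of 0 1] this]
  have "computable 2 (\<lambda>xs. rec_nat (tl xs ! 0) g (xs ! 0))"
    by (simp add: numeral_2_eq_2)
  then show "computable 2 (\<lambda>xs. rec_nat (xs ! 1) g (xs ! 0))"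
    by (rule computable_cong) (simp add: nth_tl)
qed

text \<open>Iteration is primitive recursion whose step ignores the counter. The step is unary and
  has no parameters, so all data that vary with the input must be packed into the iterated
  number.\<close>

lemma computable_funpow:
  assumes "computable 1 (\<lambda>xs. g (xs ! 0))" "computable n h" "computable n k"
  shows "computable n (\<lambda>xs. (g ^^ h xs) (k xs))"
proof -
  have "(g ^^ m) a = rec_nat a (\<lambda>_. g) m" for m a
    by (induction m) simp_all
  moreover have "computable 2 (\<lambda>xs. g (xs ! 1))"
    by (rule computable_comp1[OF assms(1)]) (simp add: computable_nth)
  ultimately show ?thesis
    using computable_rec_nat1[of "\<lambda>_. g"] assms(2,3) by simp
qed

lemma computable_add [computable_intros]:
  assumes "computable n f" "computable n g"
  shows "computable n (\<lambda>xs. f xs + g xs)"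
proof -
  have "(Suc ^^ a) b = a + b" for a b
    by (induction a) simp_all
  then show ?thesis
    using computable_funpow[of Suc, OF _ assms] by (simp add: computable_Suc computable_nth)
qed

lemma computable_pred: "computable n f \<Longrightarrow> computable n (\<lambda>xs. f xs - 1)"
proof -
  have "rec_nat 0 (\<lambda>m _. m) a = a - 1" for a
    by (cases a) simp_all
  then show "computable n f \<Longrightarrow> ?thesis"
    using computable_rec_nat0[of "\<lambda>m _. m" n f 0] by (simp add: computable_nth)
qed

lemma computable_diff [computable_intros]:
  assumes "computable n f" "computable n g"
  shows "computable n (\<lambda>xs. f xs - g xs)"
proof -
  have "((\<lambda>m. m - 1) ^^ a) b = b - a" for a b :: nat
    by (induction a) simp_all
  then show ?thesis
    using computable_funpow[of "\<lambda>m. m - 1", OF _ assms(2,1)] computable_pred[OF computable_nth[of 0 1]]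
    by simp
qed

text \<open>The sum of both truncated differences vanishes exactly at equality; a recursion on it
  that discards its previous value then selects the branch.\<close>

lemma computable_if [computable_intros]:
  assumes "computable n f" "computable n g" "computable n h" "computable n k"
  shows "computable n (\<lambda>xs. if f xs = g xs then h xs else k xs)"
proof -
  have "computable 3 (\<lambda>xs. rec_nat (xs ! 1) (\<lambda>_ _. xs ! 2) (xs ! 0))"
  proof (rule computable_cong)
    \<comment> \<open>Prefixing \<open>m # r\<close> to the tail shifts indices: entry 3 is
      \<open>xs ! 2\<close>.\<close>
    show "computable 3 (\<lambda>xs. rec_nat (tl xs ! 0) (\<lambda>m r. (m # r # tl xs) ! 3) (xs ! 0))"
      using computable_prim_rec[OF computable_nth[of 0 2] computable_nth[of 3 "2 + 2"]]
      by (simp add: numeral_3_eq_3 numeral_2_eq_2)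
  qed (simp add: nth_tl numeral_3_eq_3 numeral_2_eq_2)
  from computable_comp3[OF this, of n "\<lambda>xs. (f xs - g xs) + (g xs - f xs)" h k] assms
  have *: "computable n (\<lambda>xs. rec_nat (h xs) (\<lambda>_ _. k xs) ((f xs - g xs) + (g xs - f xs)))"
    by (simp add: computable_add computable_diff)
  have "rec_nat (h xs) (\<lambda>_ _. k xs) ((f xs - g xs) + (g xs - f xs)) =
      (if f xs = g xs then h xs else k xs)" for xs
    by (cases "(f xs - g xs) + (g xs - f xs)") auto
  with * show ?thesis by simp
qed

section \<open>Pairs, lists and halves\<close>

lemma computable_triangle: "computable n f \<Longrightarrow> computable n (\<lambda>xs. triangle (f xs))"
proof -
  have "rec_nat 0 (\<lambda>m r. r + Suc m) a = triangle a" for a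
    by (induction a) simp_all
  moreover have "computable 2 (\<lambda>xs. xs ! 1 + Suc (xs ! 0))"
    by (intro computable_intros) simp_all
  ultimately show "computable n f \<Longrightarrow> ?thesis"
    using computable_rec_nat0[of "\<lambda>m r. r + Suc m" n f 0] by simp
qed

lemma computable_prod_encode [computable_intros]:
  "computable n f \<Longrightarrow> computable n g \<Longrightarrow> computable n (\<lambda>xs. prod_encode (f xs, g xs))"
  by (simp add: prod_encode_def computable_triangle computable_add)

text \<open>The diagonal on which a pair lies is found by minimization; it determines both components.\<close>

definition diagonal :: "nat \<Rightarrow> nat" where
  "diagonal m = (LEAST k. Suc m - triangle (Suc k) = 0)"

text \<open>The code is \<open>triangle (a + b) + a\<close>, which lies below
  \<open>triangle (Suc (a + b))\<close>; the truncated difference is 0 exactly if the code is below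
  \<open>triangle (Suc k)\<close>.\<close>

lemma diagonal_prod_encode: "diagonal (prod_encode (a, b)) = a + b"
  unfolding diagonal_def
proof (rule Least_equality)
  show "Suc (prod_encode (a, b)) - triangle (Suc (a + b)) = 0"
    by (simp add: prod_encode_def)
  fix k assume *: "Suc (prod_encode (a, b)) - triangle (Suc k) = 0"
  show "a + b \<le> k"
  proof (rule ccontr)
    assume "\<not> a + b \<le> k"
    then have "triangle (Suc k) \<le> triangle (a + b)"
      unfolding triangle_def by (intro div_le_mono mult_le_mono) auto
    with * show False by (simp add: prod_encode_def del: triangle_Suc)
  qed
qed

lemma computable_diagonal:
  assumes "computable n f"
  shows "computable n (\<lambda>xs. diagonal (f xs))"
proof (rule computable_comp1[of diagonal, OF _ assms])
  let ?f = "\<lambda>xs. Suc (xs ! 1) - triangle (Suc (xs ! 0))"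
  have "computable (1 + 1) ?f"
    by (intro computable_intros computable_triangle) simp_all
  moreover have "\<exists>y. ?f (y # xs) = 0" for xs
  proof
    have "m \<le> triangle m" for m by (induction m) auto
    then show "?f (xs ! 0 # xs) = 0" by (simp add: le_SucI trans_le_add2)
  qed
  ultimately have "computable 1 (\<lambda>xs. LEAST y. ?f (y # xs) = 0)"
    by (rule computable_minim)
  then show "computable 1 (\<lambda>xs. diagonal (xs ! 0))"
    by (simp add: diagonal_def)
qed

lemma computable_fst_prod_decode [computable_intros]:
  assumes "computable n f"
  shows "computable n (\<lambda>xs. fst (prod_decode (f xs)))"
proof -
  have "m - triangle (diagonal m) = fst (prod_decode m)" for m
  proof -
    obtain a b where "m = prod_encode (a, b)" by (metis prod_decode_inverse surj_pair)
    then show ?thesis by (simp add: diagonal_prod_encode) (simp add: prod_encode_def)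
  qed
  then show ?thesis
    using computable_diff[OF assms computable_triangle[OF computable_diagonal[OF assms]]] by simp
qed

lemma computable_snd_prod_decode [computable_intros]:
  assumes "computable n f"
  shows "computable n (\<lambda>xs. snd (prod_decode (f xs)))"
proof -
  have "diagonal m - fst (prod_decode m) = snd (prod_decode m)" for m
  proof -
    obtain a b where "m = prod_encode (a, b)" by (metis prod_decode_inverse surj_pair)
    then show ?thesis by (simp add: diagonal_prod_encode)
  qed
  then show ?thesis
    using computable_diff[OF computable_diagonal[OF assms] computable_fst_prod_decode[OF assms]]
    by simp
qed

lemma computable_list_encode_Cons [computable_intros]:
  "computable n f \<Longrightarrow> computable n (\<lambda>xs. list_encode (g xs)) \<Longrightarrow>
    computable n (\<lambda>xs. list_encode (f xs # g xs))"
  by (simp add: computable_Suc computable_prod_encode)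

definition lhd :: "nat \<Rightarrow> nat" where
  "lhd m = fst (prod_decode (m - 1))"

definition ltl :: "nat \<Rightarrow> nat" where
  "ltl m = snd (prod_decode (m - 1))"

lemma lhd_Cons [simp]: "lhd (Suc (prod_encode (x, m))) = x"
  by (simp add: lhd_def)

lemma ltl_Cons [simp]: "ltl (Suc (prod_encode (x, m))) = m"
  by (simp add: ltl_def)

lemma computable_lhd [computable_intros]: "computable n f \<Longrightarrow> computable n (\<lambda>xs. lhd (f xs))"
  unfolding lhd_def by (intro computable_intros)

lemma computable_ltl [computable_intros]: "computable n f \<Longrightarrow> computable n (\<lambda>xs. ltl (f xs))"
  unfolding ltl_def by (intro computable_intros)

text \<open>\<open>Suc m div 2\<close> is the next value of \<open>m div 2\<close>, so the pair of
  both halves advances by a swap and one successor, without any division.\<close>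

lemma computable_halves:
  assumes "computable n f"
  shows computable_div2: "computable n (\<lambda>xs. f xs div 2)"
    and computable_Suc_div2: "computable n (\<lambda>xs. Suc (f xs) div 2)"
proof -
  let ?s = "\<lambda>s. prod_encode (snd (prod_decode s), Suc (fst (prod_decode s)))"
  have s: "(?s ^^ m) (prod_encode (0, 0)) = prod_encode (m div 2, Suc m div 2)" for m
    by (induction m) simp_all
  have "computable 1 (\<lambda>xs. ?s (xs ! 0))"
    by (intro computable_intros) simp_all
  from computable_funpow[OF this assms computable_const[of _ "prod_encode (0, 0)"]]
  have *: "computable n (\<lambda>xs. prod_encode (f xs div 2, Suc (f xs) div 2))"
    by (simp add: s)
  show "computable n (\<lambda>xs. f xs div 2)" "computable n (\<lambda>xs. Suc (f xs) div 2)"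
    using computable_fst_prod_decode[OF *] computable_snd_prod_decode[OF *] by simp_all
qed

lemmas [computable_intros] = computable_div2 computable_Suc_div2

section \<open>Effectivity of the translation\<close>

text \<open>The recursions of the translation are all simulated by iterating a step function on coded
  states that leaves final states unchanged; the code of the input bounds the number of steps.\<close>

lemma funpow_stable:
  assumes "(f ^^ m) x = y" "f y = y" "m \<le> n"
  shows "(f ^^ n) x = y"
proof -
  have "(f ^^ k) y = y" for k by (induction k) (simp_all add: assms(2))
  then show ?thesis
    using assms(1,3) funpow_add[of "n - m" m f] by simp
qed

section \<open>Codes of comparison formulas\<close>

lemma int_encode_eq_0: "int_encode c = 0 \<longleftrightarrow> c = 0"
  by (auto simp: int_encode_def sum_encode_def)

text \<open>\<open>int_encode\<close> sends n to 2n and -n-1 to 2n+1. The half rounded up is thus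
  the absolute value for either sign, and the two halves agree exactly on non-negative
  integers.\<close>

lemma Suc_int_encode_div2: "Suc (int_encode c) div 2 = nat \<bar>c\<bar>"
  by (auto simp: int_encode_def sum_encode_def)

lemma int_encode_div2_eq: "int_encode c div 2 = nat \<bar>c\<bar> \<longleftrightarrow> 0 \<le> c"
  by (auto simp: int_encode_def sum_encode_def)

text \<open>Only equality tests are used. The parity test accepts \<open>c = 0\<close>, which
  \<open>lt_form\<close> treats like a negative bound, so 0 is split off first.
  \<open>prod_encode (prod_encode (b, n), 0)\<close> codes the interval from n to infinity, closed
  for b = 0 and open for b = 1.\<close>

definition lt_code :: "nat \<Rightarrow> nat \<Rightarrow> nat" where
  "lt_code a m =
    (if m = 0 then list_encode [4, prod_encode (prod_encode (1, Suc m div 2), 0), a]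
     else if m div 2 = Suc m div 2
     then list_encode [2, list_encode [3, prod_encode (prod_encode (0, Suc m div 2), 0), a]]
     else list_encode [4, prod_encode (prod_encode (1, Suc m div 2), 0), a])"

definition le_code :: "nat \<Rightarrow> nat \<Rightarrow> nat" where
  "le_code a m =
    (if m div 2 = Suc m div 2
     then list_encode [2, list_encode [3, prod_encode (prod_encode (1, Suc m div 2), 0), a]]
     else list_encode [4, prod_encode (prod_encode (0, Suc m div 2), 0), a])"

definition cmp_code :: "nat \<Rightarrow> nat \<Rightarrow> nat \<Rightarrow> nat" where
  "cmp_code a m r =
    (if r = 0 then lt_code a m
     else if r = 1 then le_code a m
     else if r = 2 then list_encode [2, le_code a m]
     else if r = 3 then list_encode [2, lt_code a m]
     else list_encode [1, le_code a m, list_encode [2, lt_code a m]])"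

lemma lt_code_gn: "lt_code (gn_mitl \<psi>) (int_encode c) = gn_mitl (lt_form \<psi> c)"
  unfolding lt_code_def lt_form_def Suc_int_encode_div2 int_encode_div2_eq int_encode_eq_0 by auto

lemma le_code_gn: "le_code (gn_mitl \<psi>) (int_encode c) = gn_mitl (le_form \<psi> c)"
  unfolding le_code_def le_form_def Suc_int_encode_div2 int_encode_div2_eq by auto

lemma cmp_code_gn: "cmp_code (gn_mitl \<psi>) (int_encode c) (gn_cmp r) = gn_mitl (cmp_form \<psi> c r)"
  by (cases r) (simp_all add: cmp_code_def lt_code_gn le_code_gn)

lemma computable_cmp_code [computable_intros]:
  "computable n f \<Longrightarrow> computable n g \<Longrightarrow> computable n h \<Longrightarrow>
    computable n (\<lambda>xs. cmp_code (f xs) (g xs) (h xs))"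
  unfolding cmp_code_def lt_code_def le_code_def by (intro computable_intros)

section \<open>Variable lookup and guards on codes\<close>

primrec env_code :: "('a::finite, 'x::finite) env \<Rightarrow> nat" where
  "env_code [] = 0"
| "env_code (b # e) =
     Suc (prod_encode (prod_encode (to_nat (fst b), gn_mitl (snd b)), env_code e))"

text \<open>\<open>env_code\<close> has the layout of \<open>list_encode\<close>, so
  \<open>lhd\<close> and \<open>ltl\<close> walk through it. A hit is a fixed point like the empty
  list: surplus iterations cannot run past it, and the entry is read off afterwards.\<close>

definition lookup_step :: "nat \<Rightarrow> nat" where
  "lookup_step s =
    (if snd (prod_decode s) = 0 then s
     else if fst (prod_decode (lhd (snd (prod_decode s)))) = fst (prod_decode s) then s
     else prod_encode (fst (prod_decode s), ltl (snd (prod_decode s))))"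

definition lookup_result :: "nat \<Rightarrow> nat \<Rightarrow> nat" where
  "lookup_result d e = (if e = 0 then d else snd (prod_decode (lhd e)))"

definition lookup_code :: "nat \<Rightarrow> nat \<Rightarrow> nat \<Rightarrow> nat" where
  "lookup_code d e x =
    lookup_result d (snd (prod_decode ((lookup_step ^^ e) (prod_encode (x, e)))))"

lemma computable_lookup_code [computable_intros]:
  assumes "computable n f" "computable n g" "computable n h"
  shows "computable n (\<lambda>xs. lookup_code (f xs) (g xs) (h xs))"
proof -
  have "computable 1 (\<lambda>xs. lookup_step (xs ! 0))"
    unfolding lookup_step_def by (intro computable_intros) simp_all
  then show ?thesis
    unfolding lookup_code_def lookup_result_def
    by (intro computable_intros computable_funpow assms)
qed

text \<open>Any sufficient number of steps is allowed, because in the induction the steps left after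
  passing an entry only bound the code of the tail.\<close>

lemma lookup_step_funpow:
  fixes e :: "('a::finite, 'x::finite) env"
  assumes "env_code e \<le> n"
  shows "lookup_result (gn_mitl (first_form :: 'a mitl))
    (snd (prod_decode ((lookup_step ^^ n) (prod_encode (to_nat x, env_code e))))) =
    gn_mitl (lookup e x)"
  using assms
proof (induction e arbitrary: n)
  case Nil
  have "(lookup_step ^^ n) (prod_encode (to_nat x, 0)) = prod_encode (to_nat x, 0)"
    by (rule funpow_stable[where m = 0]) (simp_all add: lookup_step_def)
  then show ?case by (simp add: lookup_result_def)
next
  case (Cons b e)
  obtain y \<psi> where b: "b = (y, \<psi>)" by (cases b)
  show ?case
  proof (cases "y = x")
    case True
    let ?s = "prod_encode (to_nat x, env_code (b # e))"
    have "(lookup_step ^^ n) ?s = ?s"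
      by (rule funpow_stable[where m = 0]) (simp_all add: lookup_step_def b True)
    then show ?thesis by (simp add: lookup_result_def b True)
  next
    case False
    from Cons.prems obtain m where n: "n = Suc m" by (cases n) auto
    have "env_code e \<le> m"
      using Cons.prems n le_prod_encode_2[of "env_code e"] by (auto intro: order_trans)
    moreover have "lookup_step (prod_encode (to_nat x, env_code (b # e))) =
        prod_encode (to_nat x, env_code e)"
      using False by (simp add: lookup_step_def b)
    ultimately show ?thesis
      using Cons.IH[of m] False by (simp add: n b funpow_swap1 del: env_code.simps)
  qed
qed

lemma lookup_code_gn:
  "lookup_code (gn_mitl (first_form :: 'a mitl)) (env_code (e :: ('a::finite, 'x::finite) env)) (to_nat x) = gn_mitl (lookup e x)"
  unfolding lookup_code_def by (rule lookup_step_funpow) simp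

text \<open>The tree recursion of \<^const>\<open>guard_form\<close> runs as a stack machine; a state consists of the
  environment, the stack of guards still to be conjoined, and the formula built so far.\<close>

definition guard_step' :: "nat \<Rightarrow> nat \<Rightarrow> nat \<Rightarrow> nat \<Rightarrow> nat \<Rightarrow> nat" where
  "guard_step' d e g st a =
    (if lhd g = 0
     then prod_encode (e, prod_encode
       (Suc (prod_encode (lhd (ltl g), Suc (prod_encode (lhd (ltl (ltl g)), st)))), a))
     else prod_encode (e, prod_encode (st, list_encode [1, a,
       cmp_code (lookup_code d e (lhd (ltl g))) (lhd (ltl (ltl (ltl g)))) (lhd (ltl (ltl g)))])))"

definition guard_step :: "nat \<Rightarrow> nat \<Rightarrow> nat" where
  "guard_step d s =
    (if fst (prod_decode (snd (prod_decode s))) = 0 then s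
     else guard_step' d (fst (prod_decode s)) (lhd (fst (prod_decode (snd (prod_decode s)))))
       (ltl (fst (prod_decode (snd (prod_decode s))))) (snd (prod_decode (snd (prod_decode s)))))"

definition guard_code :: "nat \<Rightarrow> nat \<Rightarrow> nat \<Rightarrow> nat \<Rightarrow> nat" where
  "guard_code d e g a = snd (prod_decode (snd (prod_decode
    ((guard_step d ^^ g) (prod_encode (e, prod_encode (Suc (prod_encode (g, 0)), a)))))))"

text \<open>\<open>d\<close> is one fixed number and may occur in the step function; the environment
  varies with the input and travels in the state.\<close>

lemma computable_guard_code [computable_intros]:
  assumes "computable n f" "computable n g" "computable n h"
  shows "computable n (\<lambda>xs. guard_code d (f xs) (g xs) (h xs))"
proof -
  have "computable 1 (\<lambda>xs. guard_step d (xs ! 0))"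
    unfolding guard_step_def guard_step'_def by (intro computable_intros) simp_all
  then show ?thesis
    unfolding guard_code_def
    by (intro computable_intros computable_funpow assms)
qed

primrec guard_nodes :: "'x guard \<Rightarrow> nat" where
  "guard_nodes (GAnd g h) = Suc (guard_nodes g + guard_nodes h)"
| "guard_nodes (Diff x r c) = 1"

text \<open>Bounding each component alone would not do: the steps for two subtrees add up.\<close>

lemma add_le_prod_encode: "a + b \<le> prod_encode (a, b)"
proof -
  have "m \<le> triangle m" for m by (induction m) auto
  then show ?thesis by (simp add: prod_encode_def trans_le_add1)
qed

lemma guard_nodes_le: "guard_nodes g \<le> gn_guard g"
proof (induction g)
  case (GAnd g h)
  show ?case
    using GAnd add_le_prod_encode[of 0 "Suc (prod_encode (gn_guard g, Suc (prod_encode (gn_guard h, 0))))"]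
      add_le_prod_encode[of "gn_guard g" "Suc (prod_encode (gn_guard h, 0))"]
      add_le_prod_encode[of "gn_guard h" 0]
    by simp
qed simp

text \<open>One step per guard node consumes exactly the top of the stack. The stack below is
  arbitrary, since the left conjunct is processed with the right one beneath it.\<close>

lemma guard_step_funpow:
  fixes e :: "('a::finite, 'x::finite) env"
  shows "(guard_step (gn_mitl (first_form :: 'a mitl)) ^^ guard_nodes g)
     (prod_encode (env_code e, prod_encode (Suc (prod_encode (gn_guard g, st)), gn_mitl \<psi>))) =
   prod_encode (env_code e, prod_encode (st, gn_mitl (guard_form e g \<psi>)))"
proof (induction g arbitrary: st \<psi>)
  case (GAnd g h)
  \<comment> \<open>\<open>funpow_add\<close> runs the right summand first: one step splits the
    conjunction, then \<open>g\<close> is consumed, then \<open>h\<close>, in the order of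
    \<open>guard_form\<close>.\<close>
  have "guard_nodes (GAnd g h) = guard_nodes h + (guard_nodes g + 1)" by simp
  then show ?case
    unfolding \<open>guard_nodes (GAnd g h) = _\<close> funpow_add
    by (simp add: GAnd guard_step_def guard_step'_def)
next
  case (Diff x r c)
  show ?case
    by (simp add: guard_step_def guard_step'_def lookup_code_gn cmp_code_gn)
qed

lemma guard_code_gn:
  fixes e :: "('a::finite, 'x::finite) env"
  shows "guard_code (gn_mitl (first_form :: 'a mitl)) (env_code e) (gn_guard g) (gn_mitl \<psi>) =
    gn_mitl (guard_form e g \<psi>)"
proof -
  have "guard_step d (prod_encode (k, prod_encode (0, a))) = prod_encode (k, prod_encode (0, a))"
    for d k a by (simp add: guard_step_def)
  from funpow_stable[OF guard_step_funpow[of g e 0 \<psi>] this guard_nodes_le] show ?thesis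
    by (simp add: guard_code_def)
qed

section \<open>Events, children and the descent on codes\<close>

definition event_code :: "nat \<Rightarrow> nat \<Rightarrow> nat \<Rightarrow> nat" where
  "event_code d e t =
    guard_code d e (snd (prod_decode t)) (list_encode [0, fst (prod_decode t)])"

lemma computable_event_code [computable_intros]:
  "computable n f \<Longrightarrow> computable n g \<Longrightarrow> computable n (\<lambda>xs. event_code d (f xs) (g xs))"
  unfolding event_code_def by (intro computable_intros)

lemma event_code_gn:
  fixes e :: "('a::finite, 'x::finite) env"
  shows "event_code (gn_mitl (first_form :: 'a mitl)) (env_code e) (gn_event \<theta>) = gn_mitl (event_form e \<theta>)"
  using guard_code_gn[of e "snd \<theta>" "Letter (fst \<theta>)"]
  by (simp add: event_code_def event_form_def gn_event_def)

definition somewhere_code :: "nat \<Rightarrow> nat" where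
  "somewhere_code a = list_encode [2, list_encode [1, list_encode [2, a],
    list_encode [1, list_encode [2, list_encode [3, gn_ival (at_least 0), a]],
      list_encode [2, list_encode [4, gn_ival (at_least 0), a]]]]]"

text \<open>\<open>k\<close> is 4 for the next and 3 for the previous modality, the tag of \<^const>\<open>P\<close> resp. \<^const>\<open>F\<close>.\<close>

definition nearest_code :: "nat \<Rightarrow> nat \<Rightarrow> nat \<Rightarrow> nat" where
  "nearest_code k a t =
    list_encode [1, list_encode [1, t, list_encode [k, gn_ival (at_least 0), a]],
      list_encode [2, list_encode [k, gn_ival (at_least 0),
        list_encode [1, t, list_encode [k, gn_ival (at_least 0), a]]]]]"

definition child_form_code :: "nat \<Rightarrow> nat \<Rightarrow> nat \<Rightarrow> nat \<Rightarrow> nat \<Rightarrow> nat" where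
  "child_form_code d l e a f =
    (if lhd f = 2 then list_encode [1, d, somewhere_code a]
     else if lhd f = 3 then list_encode [1, l, somewhere_code a]
     else if lhd f = 4 then nearest_code 4 a (event_code d e (lhd (ltl f)))
     else if lhd f = 5 then nearest_code 3 a (event_code d e (lhd (ltl f)))
     else a)"

definition child_env_code :: "nat \<Rightarrow> nat \<Rightarrow> nat \<Rightarrow> nat" where
  "child_env_code e a f =
    (if lhd f = 6 then Suc (prod_encode (prod_encode (lhd (ltl f), a), e)) else e)"

text \<open>The last branch is for \<open>Nxt\<close>, \<open>Prv\<close> and \<open>Frz\<close>,
  whose codes hold an event or a variable before the subformula.\<close>

definition child_code :: "nat \<Rightarrow> nat \<Rightarrow> nat" where
  "child_code f k =
    (if lhd f = 2 then lhd (ltl f)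
     else if lhd f = 3 then lhd (ltl f)
     else if lhd f = 8 then lhd (ltl f)
     else if lhd f = 7 then (if k = 0 then lhd (ltl f) else lhd (ltl (ltl f)))
     else lhd (ltl (ltl f)))"

lemma child_form_code_gn:
  "child_form_code (gn_mitl (first_form :: 'a mitl)) (gn_mitl (last_form :: 'a mitl)) (env_code e)
     (gn_mitl \<psi>) (gn_ttl \<phi>) = gn_mitl (child_form e (\<psi> :: 'a::finite mitl) \<phi>)"
  by (cases \<phi>) (simp_all add: child_form_code_def somewhere_code_def somewhere_def nearest_code_def
      next_form_def prev_form_def event_code_gn)

lemma child_env_code_gn:
  "child_env_code (env_code e) (gn_mitl \<psi>) (gn_ttl \<phi>) = env_code (child_env e \<psi> \<phi>)"
  by (cases \<phi>) (simp_all add: child_env_code_def)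

lemma child_code_gn:
  "k < length (children \<phi>) \<Longrightarrow> child_code (gn_ttl \<phi>) k = gn_ttl (children \<phi> ! k)"
  by (cases \<phi>) (auto simp: child_code_def less_Suc_eq)

definition node_step' :: "nat \<Rightarrow> nat \<Rightarrow> nat \<Rightarrow> nat \<Rightarrow> nat \<Rightarrow> nat \<Rightarrow> nat" where
  "node_step' d l f p a e =
    prod_encode (prod_encode (child_code f (lhd p), ltl p),
      prod_encode (child_form_code d l e a f, child_env_code e a f))"

definition node_step :: "nat \<Rightarrow> nat \<Rightarrow> nat \<Rightarrow> nat" where
  "node_step d l s =
    (if snd (prod_decode (fst (prod_decode s))) = 0 then s
     else node_step' d l (fst (prod_decode (fst (prod_decode s))))
       (snd (prod_decode (fst (prod_decode s)))) (fst (prod_decode (snd (prod_decode s))))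
       (snd (prod_decode (snd (prod_decode s)))))"

definition node_code :: "nat \<Rightarrow> nat \<Rightarrow> nat \<Rightarrow> nat \<Rightarrow> nat" where
  "node_code d l f p = fst (prod_decode (snd (prod_decode
    ((node_step d l ^^ p) (prod_encode (prod_encode (f, p), prod_encode (d, 0)))))))"

lemma computable_node_code:
  assumes "computable n f" "computable n g"
  shows "computable n (\<lambda>xs. node_code d l (f xs) (g xs))"
proof -
  have "computable 1 (\<lambda>xs. node_step d l (xs ! 0))"
    unfolding node_step_def node_step'_def child_form_code_def child_env_code_def child_code_def
      somewhere_code_def nearest_code_def
    by (intro computable_intros) simp_all
  then show ?thesis
    unfolding node_code_def by (intro computable_intros computable_funpow assms)
qed

lemma node_step_funpow:
  fixes \<psi> :: "'a::finite mitl"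
  assumes "is_node \<phi> p" "list_encode p \<le> n"
  shows "fst (prod_decode (snd (prod_decode
    ((node_step (gn_mitl (first_form :: 'a mitl)) (gn_mitl (last_form :: 'a mitl)) ^^ n)
      (prod_encode (prod_encode (gn_ttl \<phi>, list_encode p), prod_encode (gn_mitl \<psi>, env_code e)))))))
    = gn_mitl (node_form e \<psi> \<phi> p)"
  using assms
proof (induction p arbitrary: n e \<psi> \<phi>)
  case Nil
  let ?s = "prod_encode (prod_encode (gn_ttl \<phi>, list_encode []), prod_encode (gn_mitl \<psi>, env_code e))"
  have "(node_step (gn_mitl (first_form :: 'a mitl)) (gn_mitl (last_form :: 'a mitl)) ^^ n) ?s = ?s"
    by (rule funpow_stable[where m = 0]) (simp_all add: node_step_def)
  then show ?case by simp
next
  case (Cons k p)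
  from Cons.prems obtain m where n: "n = Suc m" by (cases n) auto
  have "list_encode p \<le> m"
    using Cons.prems n le_prod_encode_2[of "list_encode p"] by (auto intro: order_trans)
  moreover have "node_step (gn_mitl (first_form :: 'a mitl)) (gn_mitl (last_form :: 'a mitl))
      (prod_encode (prod_encode (gn_ttl \<phi>, list_encode (k # p)), prod_encode (gn_mitl \<psi>, env_code e))) =
    prod_encode (prod_encode (gn_ttl (children \<phi> ! k), list_encode p),
      prod_encode (gn_mitl (child_form e \<psi> \<phi>), env_code (child_env e \<psi> \<phi>)))"
    using Cons.prems(1)
    by (simp add: node_step_def node_step'_def child_code_gn child_form_code_gn child_env_code_gn)
  ultimately show ?case
    using Cons.IH[of "children \<phi> ! k" m] Cons.prems(1)
    by (simp add: n funpow_swap1 del: list_encode.simps)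
qed

lemma effective_pos_form:
  "effective (pos_form :: ('a::finite, 'x::finite) ttl \<Rightarrow> nat list \<Rightarrow> 'a mitl)"
proof -
  let ?f = "node_code (gn_mitl (first_form :: 'a mitl)) (gn_mitl (last_form :: 'a mitl))"
  have "computable 2 (\<lambda>xs. ?f (xs ! 0) (xs ! 1))"
    by (intro computable_node_code computable_nth) simp_all
  then obtain g where g: "recfn 2 g" "\<And>xs. length xs = 2 \<Longrightarrow> g xs = ?f (xs ! 0) (xs ! 1)"
    unfolding computable_def by metis
  have "g [gn_ttl \<phi>, list_encode p] = gn_mitl (pos_form \<phi> p)"
    if "is_node \<phi> p" for \<phi> :: "('a, 'x) ttl" and p
    using node_step_funpow[OF that order_refl, of first_form "[]"] g(2)[of "[gn_ttl \<phi>, list_encode p]"]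
    by (simp add: node_code_def pos_form_def)
  with g(1) show ?thesis unfolding effective_def by blast
qed

theorem lemma2:
  shows "\<exists>\<alpha> :: ('a::finite, 'x::finite) ttl \<Rightarrow> nat list \<Rightarrow> 'a mitl.
    effective \<alpha> \<and>
    (\<forall>\<phi> \<eta>. is_node \<phi> \<eta> \<longrightarrow>
       is_mitl (\<alpha> \<phi> \<eta>) \<and>
       (\<forall>\<rho> j. timed_word \<rho> \<longrightarrow> j \<in> wdom \<rho> \<longrightarrow>
          (pos \<rho> \<phi> \<eta> = Some j \<longleftrightarrow> mitl_sat \<rho> j (\<alpha> \<phi> \<eta>))))"
  using effective_pos_form is_mitl_pos_form pos_eq_iff_pos_form by blast

end
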